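(* Let $n$ be any positive integer. Then $$r_{16}(n)=-(-1)^n\cdot\tfrac{32}{3}\left[\tilde\sigma_1(n)+\tilde\sigma_3(n)+\tilde\sigma_5(n)\right]+(-1)^n\cdot\tfrac{256}{3}\sum_{m=1}^{n-1}\left[\tilde\sigma_1(m)\tilde\sigma_5(n-m)-\tilde\sigma_3(m)\tilde\sigma_3(n-m)\right]$$ and $$r_{24}(n)=(-1)^n\cdot\tfrac{16}{9}\left[17\,\sigma_3^{\dagger}(n)+8\,\sigma_5^{\dagger}(n)+2\,\sigma_7^{\dagger}(n)\right]+(-1)^n\cdot\tfrac{512}{9}\sum_{m=1}^{n-1}\left[\sigma_3^{\dagger}(m)\sigma_7^{\dagger}(n-m)-\sigma_5^{\dagger}(m)\sigma_5^{\dagger}(n-m)\right].$$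
   Context: $r_s(n)$ denotes the number of integer solutions $(x_1,\dots,x_s)\in\mathbb Z^s$ of $x_1^2+\cdots+x_s^2=n$ (changing the sign or the order of the $x_i$ gives distinct solutions). For positive integers $r,n$, $$\tilde\sigma_r(n):=\sum_{d\mid n,\,d>0}(-1)^{d+n/d}d^r,\qquad \sigma_r^{\dagger}(n):=\sum_{d\mid n,\,d>0}(-1)^{d}d^r.$$ *)

theory Defs
  imports Complex_Main
begin

text \<open>The solution set is finite, so the cardinality is the true count.\<close>

definition rep_squares :: "nat \<Rightarrow> nat \<Rightarrow> nat" where
  "rep_squares s n = card {xs :: int list. length xs = s \<and> (\<Sum>x\<leftarrow>xs. x\<^sup>2) = int n}"

text \<open>The next two functions are only meant for \<open>n > 0\<close>.\<close>

definition sigma_tilde :: "nat \<Rightarrow> nat \<Rightarrow> int" where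
  "sigma_tilde r n = (\<Sum>d | d dvd n \<and> d > 0. (-1) ^ (d + n div d) * int d ^ r)"

definition sigma_dagger :: "nat \<Rightarrow> nat \<Rightarrow> int" where
  "sigma_dagger r n = (\<Sum>d | d dvd n \<and> d > 0. (-1) ^ d * int d ^ r)"

lemma finite_rep_squares:
  "finite {xs :: int list. length xs = s \<and> (\<Sum>x\<leftarrow>xs. x\<^sup>2) = int n}"
proof (rule finite_subset)
  show "finite {xs :: int list. set xs \<subseteq> {- int n..int n} \<and> length xs = s}"
    by (rule finite_lists_length_eq) simp
  have "x \<in> {- int n..int n}" if "x \<in> set xs" "(\<Sum>x\<leftarrow>xs. x\<^sup>2) = int n" for x :: int and xs
  proof -
    have "x\<^sup>2 \<le> (\<Sum>x\<leftarrow>xs. x\<^sup>2)"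
      using that(1) by (intro member_le_sum_list) auto
    moreover have "\<bar>x\<bar> \<le> x\<^sup>2"
    proof (cases "x = 0")
      case False
      then have "\<bar>x\<bar> * 1 \<le> \<bar>x\<bar> * \<bar>x\<bar>"
        by (intro mult_left_mono) linarith+
      then show ?thesis
        by (simp add: power2_eq_square)
    qed simp
    ultimately show ?thesis
      using that(2) by auto
  qed
  then show "{xs :: int list. length xs = s \<and> (\<Sum>x\<leftarrow>xs. x\<^sup>2) = int n}
      \<subseteq> {xs. set xs \<subseteq> {- int n..int n} \<and> length xs = s}"
    by blast
qed

end

theory Submission
  imports Defs "HOL-Computational_Algebra.Formal_Power_Series"
begin

text \<open>
  Write \<open>\<theta> = \<Sum>x. (-1)^x q^(x^2)\<close>, where \<open>x\<close> ranges over the integers, and let \<open>U r\<close>, \<open>G r\<close> be the power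
  series with coefficients \<open>sigma_tilde r\<close>, \<open>sigma_dagger r\<close>.

  The step \<open>(a, k, b, l) \<mapsto> (a - b, k, b, k + l)\<close> of the Euclidean algorithm preserves the value of
  \<open>a k + b l\<close>. In the manner of Liouville it yields an identity for an arbitrary even function, and one
  for an arbitrary odd function, whose instances at \<open>(-1)^x x^j\<close> are quadratic relations between the
  series. In terms of elliptic functions they are the Taylor coefficients of \<open>f^2 = y + const\<close> and
  of \<open>f'' = 2 f^3 + const f\<close>. Elimination gives the right hand sides of the theorem as
  \<open>(1 - 8 U 1)^4\<close> and \<open>(1 - 8 U 1)^6\<close>.

  It remains to see Jacobi's theorem \<open>1 - 8 U 1 = \<theta>^4\<close>. Both sides satisfy the same first order
  differential equation; for \<open>1 - 8 U 1\<close> this is a statement about sums over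
  \<open>x^2 + a b = n\<close>, where the cubic form \<open>(a + b) (a b - 4 x^2 - 2 (a - b) x)\<close> changes its sign under
  the involution \<open>(x, a, b) \<mapsto> (b - x, a + 2 x - b, b)\<close>.
\<close>

subsection \<open>Sums over \<open>a k + b l = n\<close>\<close>

text \<open>Read \<open>n\<close> as \<open>k\<close> copies of a part \<open>a\<close> plus
  \<open>l\<close> copies of a part \<open>b\<close>. The condition \<open>P\<close> is separate
  from the summand so that one sum can be cut in two ways: by comparing the parts or by comparing
  the multiplicities.\<close>

definition qsum :: "nat \<Rightarrow> (nat \<Rightarrow> nat \<Rightarrow> nat \<Rightarrow> nat \<Rightarrow> bool) \<Rightarrow> (nat \<Rightarrow> nat \<Rightarrow> nat \<Rightarrow> nat \<Rightarrow> real) \<Rightarrow> real" where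
  "qsum n P F = (\<Sum>(a, k, b, l) \<in> {(a, k, b, l). 0 < a \<and> 0 < k \<and> 0 < b \<and> 0 < l \<and> a * k + b * l = n \<and> P a k b l}. F a k b l)"

definition dsum :: "nat \<Rightarrow> (nat \<Rightarrow> nat \<Rightarrow> real) \<Rightarrow> real" where
  "dsum n F = (\<Sum>(d, m) \<in> {(d, m). 0 < d \<and> 0 < m \<and> d * m = n}. F d m)"

text \<open>The double series of \<open>F d m * q ^ (d * m)\<close> over positive \<open>d\<close>
  and \<open>m\<close>; its constant coefficient is 0.\<close>

definition lambert :: "(nat \<Rightarrow> nat \<Rightarrow> real) \<Rightarrow> real fps" where
  "lambert F = Abs_fps (\<lambda>n. dsum n F)"

lemma factor_le:
  fixes a b :: nat
  assumes "0 < a" "0 < b"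
  shows "a \<le> a * b" "b \<le> a * b"
  using assms by simp_all

lemma finite_divisor_pairs: "finite {(d, m). 0 < d \<and> 0 < m \<and> d * m = (n::nat)}"
  by (rule finite_subset[of _ "{..n} \<times> {..n}"]) (auto dest: factor_le)

lemma finite_quads:
  "finite {(a, k, b, l). 0 < a \<and> 0 < k \<and> 0 < b \<and> 0 < l \<and> a * k + b * l = (n::nat) \<and> P a k b l}"
proof (rule finite_subset)
  show "{(a, k, b, l). 0 < a \<and> 0 < k \<and> 0 < b \<and> 0 < l \<and> a * k + b * l = n \<and> P a k b l}
      \<subseteq> {..n} \<times> {..n} \<times> {..n} \<times> {..n}"
    by (auto intro: order_trans[OF factor_le(1)] order_trans[OF factor_le(2)] trans_le_add1 trans_le_add2)
qed auto

lemma qsum_cong: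
  assumes "\<And>a k b l. \<lbrakk>0 < a; 0 < k; 0 < b; 0 < l; P a k b l\<rbrakk> \<Longrightarrow> F a k b l = G a k b l"
  shows "qsum n P F = qsum n P G"
  unfolding qsum_def by (rule sum.cong) (auto simp: assms)

lemma dsum_cong:
  assumes "\<And>d m. \<lbrakk>0 < d; 0 < m; d * m = n\<rbrakk> \<Longrightarrow> F d m = G d m"
  shows "dsum n F = dsum n G"
  unfolding dsum_def by (rule sum.cong) (auto simp: assms)

lemma qsum_linear:
  "qsum n P (\<lambda>a k b l. F a k b l + G a k b l) = qsum n P F + qsum n P G"
  "qsum n P (\<lambda>a k b l. F a k b l - G a k b l) = qsum n P F - qsum n P G"
  "qsum n P (\<lambda>a k b l. c * F a k b l) = c * qsum n P F"
  "qsum n P (\<lambda>a k b l. - F a k b l) = - qsum n P F"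
  by (simp_all add: qsum_def case_prod_unfold sum.distrib sum_subtractf sum_distrib_left sum_negf)

lemma dsum_linear:
  "dsum n (\<lambda>d m. F d m + G d m) = dsum n F + dsum n G"
  "dsum n (\<lambda>d m. F d m - G d m) = dsum n F - dsum n G"
  "dsum n (\<lambda>d m. c * F d m) = c * dsum n F"
  "dsum n (\<lambda>d m. - F d m) = - dsum n F"
  by (simp_all add: dsum_def case_prod_unfold sum.distrib sum_subtractf sum_distrib_left sum_negf)

lemma qsum_disjoint_union:
  assumes "\<And>a k b l. P a k b l \<longleftrightarrow> Q a k b l \<or> R a k b l"
    and "\<And>a k b l. \<not> (Q a k b l \<and> R a k b l)"
  shows "qsum n P F = qsum n Q F + qsum n R F"
proof -
  have "{(a, k, b, l). 0 < a \<and> 0 < k \<and> 0 < b \<and> 0 < l \<and> a * k + b * l = n \<and> P a k b l} =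
    {(a, k, b, l). 0 < a \<and> 0 < k \<and> 0 < b \<and> 0 < l \<and> a * k + b * l = n \<and> Q a k b l} \<union>
    {(a, k, b, l). 0 < a \<and> 0 < k \<and> 0 < b \<and> 0 < l \<and> a * k + b * l = n \<and> R a k b l}"
    using assms(1) by auto
  then show ?thesis
    unfolding qsum_def using assms(2)
    by (simp only:) (rule sum.union_disjoint[OF finite_quads finite_quads], auto)
qed

lemma qsum_split_parts:
  "qsum n (\<lambda>a k b l. True) F = qsum n (\<lambda>a k b l. b < a) F + qsum n (\<lambda>a k b l. a = b) F + qsum n (\<lambda>a k b l. a < b) F"
proof -
  have "qsum n (\<lambda>a k b l. True) F = qsum n (\<lambda>a k b l. b < a \<or> a = b) F + qsum n (\<lambda>a k b l. a < b) F"
    by (rule qsum_disjoint_union) auto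
  moreover have "qsum n (\<lambda>a k b l. b < a \<or> a = b) F = qsum n (\<lambda>a k b l. b < a) F + qsum n (\<lambda>a k b l. a = b) F"
    by (rule qsum_disjoint_union) auto
  ultimately show ?thesis by simp
qed

lemma qsum_split_multiplicities:
  "qsum n (\<lambda>a k b l. True) F = qsum n (\<lambda>a k b l. k < l) F + qsum n (\<lambda>a k b l. k = l) F + qsum n (\<lambda>a k b l. l < k) F"
proof -
  have "qsum n (\<lambda>a k b l. True) F = qsum n (\<lambda>a k b l. k < l \<or> k = l) F + qsum n (\<lambda>a k b l. l < k) F"
    by (rule qsum_disjoint_union) auto
  moreover have "qsum n (\<lambda>a k b l. k < l \<or> k = l) F = qsum n (\<lambda>a k b l. k < l) F + qsum n (\<lambda>a k b l. k = l) F"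
    by (rule qsum_disjoint_union) auto
  ultimately show ?thesis by simp
qed

lemma qsum_swap: "qsum n P F = qsum n (\<lambda>a k b l. P b l a k) (\<lambda>a k b l. F b l a k)"
  unfolding qsum_def
  by (rule sum.reindex_bij_witness[where i = "\<lambda>(a, k, b, l). (b, l, a, k)" and j = "\<lambda>(a, k, b, l). (b, l, a, k)"])
     (auto simp: add.commute)

lemma shift_identity:
  fixes a b k l :: nat
  assumes "b < a"
  shows "(a - b) * k + b * (k + l) = a * k + b * l"
proof -
  from assms obtain c where "a = b + c" by (metis less_imp_add_positive)
  then show ?thesis by (simp add: algebra_simps)
qed

text \<open>The subtractive Euclidean step is a bijection from the region \<open>b < a\<close> to
  the region \<open>k < l\<close>, with inverse \<open>(a + b, k, b, l - k)\<close>.\<close>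

lemma qsum_shift:
  "qsum n (\<lambda>a k b l. b < a) F = qsum n (\<lambda>a k b l. k < l) (\<lambda>a k b l. F (a + b) k b (l - k))"
  unfolding qsum_def
  by (rule sum.reindex_bij_witness[where i = "\<lambda>(a, k, b, l). (a + b, k, b, l - k)" and j = "\<lambda>(a, k, b, l). (a - b, k, b, k + l)"])
     (auto simp: shift_identity, auto simp: algebra_simps diff_mult_distrib2)

lemma qsum_shift':
  "qsum n (\<lambda>a k b l. a < b) F = qsum n (\<lambda>a k b l. l < k) (\<lambda>a k b l. F a (k - l) (a + b) l)"
  using qsum_shift[of n "\<lambda>a k b l. F b l a k"]
  by (subst (1 2) qsum_swap) (simp add: add.commute)

text \<open>Two equal parts merge into a factorization with \<open>d = a = b\<close> and
  \<open>m = k + l\<close>, and \<open>l\<close> stays free. The two diagonals \<open>a = b\<close>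
  and \<open>k = l\<close>, which the shifts do not reach, supply the divisor sums in Liouville's
  identities.\<close>

lemma qsum_parts_eq:
  "qsum n (\<lambda>a k b l. a = b) F = dsum n (\<lambda>d m. \<Sum>l = 1..<m. F d (m - l) d l)"
proof -
  have "dsum n (\<lambda>d m. \<Sum>l = 1..<m. F d (m - l) d l) =
    (\<Sum>(p, l) \<in> (SIGMA p:{(d, m). 0 < d \<and> 0 < m \<and> d * m = n}. {1..<snd p}). F (fst p) (snd p - l) (fst p) l)"
    unfolding dsum_def by (subst sum.Sigma[symmetric]) (auto simp: finite_divisor_pairs[unfolded case_prod_unfold] case_prod_unfold)
  also have "\<dots> = qsum n (\<lambda>a k b l. a = b) F"
    unfolding qsum_def
    by (rule sum.reindex_bij_witness[where i = "\<lambda>(a, k, b, l). ((a, k + l), l)" and j = "\<lambda>((d, m), l). (d, m - l, d, l)"])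
       (auto simp: algebra_simps diff_mult_distrib2)
  finally show ?thesis ..
qed

lemma qsum_multiplicities_eq:
  "qsum n (\<lambda>a k b l. k = l) F = dsum n (\<lambda>d m. \<Sum>a = 1..<d. F a m (d - a) m)"
proof -
  have "dsum n (\<lambda>d m. \<Sum>a = 1..<d. F a m (d - a) m) =
    (\<Sum>(p, a) \<in> (SIGMA p:{(d, m). 0 < d \<and> 0 < m \<and> d * m = n}. {1..<fst p}). F a (snd p) (fst p - a) (snd p))"
    unfolding dsum_def by (subst sum.Sigma[symmetric]) (auto simp: finite_divisor_pairs[unfolded case_prod_unfold] case_prod_unfold)
  also have "\<dots> = qsum n (\<lambda>a k b l. k = l) F"
    unfolding qsum_def
    by (rule sum.reindex_bij_witness[where i = "\<lambda>(a, k, b, l). ((a + b, k), a)" and j = "\<lambda>((d, m), a). (a, m, d - a, m)"])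
       (auto simp: algebra_simps diff_mult_distrib)
  finally show ?thesis ..
qed

text \<open>The pair \<open>(a, k)\<close> determines the index \<open>i = a * k\<close> of the
  Cauchy product, so the outer sum is absorbed.\<close>

lemma lambert_mult_nth:
  "fps_nth (lambert F * lambert G) n = qsum n (\<lambda>a k b l. True) (\<lambda>a k b l. F a k * G b l)"
proof -
  have "fps_nth (lambert F * lambert G) n = (\<Sum>i = 0..n. dsum i F * dsum (n - i) G)"
    by (simp add: fps_mult_nth lambert_def)
  also have "\<dots> = (\<Sum>i = 0..n. \<Sum>(p, r) \<in> {(d, m). 0 < d \<and> 0 < m \<and> d * m = i} \<times> {(d, m). 0 < d \<and> 0 < m \<and> d * m = n - i}.
      F (fst p) (snd p) * G (fst r) (snd r))"
    by (simp add: dsum_def sum_product sum.cartesian_product case_prod_unfold)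
  also have "\<dots> = (\<Sum>(i, p, r) \<in> (SIGMA i:{0..n}. {(d, m). 0 < d \<and> 0 < m \<and> d * m = i} \<times> {(d, m). 0 < d \<and> 0 < m \<and> d * m = n - i}).
      F (fst p) (snd p) * G (fst r) (snd r))"
    by (subst sum.Sigma) (auto simp: finite_divisor_pairs[unfolded case_prod_unfold] case_prod_unfold)
  also have "\<dots> = qsum n (\<lambda>a k b l. True) (\<lambda>a k b l. F a k * G b l)"
    unfolding qsum_def
    by (rule sum.reindex_bij_witness[where i = "\<lambda>(a, k, b, l). (a * k, (a, k), (b, l))" and j = "\<lambda>(i, (a, k), (b, l)). (a, k, b, l)"])
       auto
  finally show ?thesis .
qed

section \<open>Liouville's identities for even and odd functions\<close>

lemma sum_alternating_signs:
  "(\<Sum>l = 1..<m. (-1) ^ l) = (if 0 < m then - (1 + (-1) ^ m) / 2 else 0 :: real)"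
proof (induction m)
  case (Suc m)
  then show ?case by (cases "m = 0") auto
qed simp

text \<open>Off the diagonals the shift turns the terms \<open>g (a - b)\<close> into
  \<open>X\<close> on \<open>k < l\<close> and the terms \<open>g (a + b)\<close> into
  \<open>X\<close> on \<open>b < a\<close>, each twice by symmetry. Cutting the full sum of
  \<open>X\<close> by parts and by multiplicities shows that these two differ by diagonal terms
  only.\<close>

lemma liouville_even:
  fixes g :: "int \<Rightarrow> real"
  assumes even: "\<And>x. g (- x) = g x" and zero: "g 0 = 0"
  shows "qsum n (\<lambda>a k b l. True) (\<lambda>a k b l. (-1) ^ (k + l) * (g (int a - int b) - g (int a + int b))) =
    - dsum n (\<lambda>d m. (real d + (-1) ^ m) * g (int d) + 2 * (-1) ^ m * (\<Sum>a = 1..<d. g (int a)))"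
proof -
  define X where "X = (\<lambda>(a::nat) (k::nat) (b::nat) (l::nat). (-1) ^ l * g (int a))"
  let ?D = "\<lambda>a k b l. (-1) ^ (k + l) * g (int a - int b)"
  let ?S = "\<lambda>a k b l. (-1) ^ (k + l) * g (int a + int b)"
  have D_less: "qsum n (\<lambda>a k b l. b < a) ?D = qsum n (\<lambda>a k b l. k < l) X"
    unfolding qsum_shift X_def by (rule qsum_cong) auto
  have D_greater: "qsum n (\<lambda>a k b l. a < b) ?D = qsum n (\<lambda>a k b l. b < a) ?D"
    by (subst qsum_swap, rule qsum_cong) (metis add.commute even minus_diff_eq)
  have D_eq: "qsum n (\<lambda>a k b l. a = b) ?D = 0"
    unfolding qsum_parts_eq dsum_def by (simp add: zero)
  have S_less: "qsum n (\<lambda>a k b l. k < l) ?S = qsum n (\<lambda>a k b l. b < a) X"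
    unfolding qsum_shift X_def
    by (rule qsum_cong) (auto simp: minus_one_power_iff)
  have S_greater: "qsum n (\<lambda>a k b l. l < k) ?S = qsum n (\<lambda>a k b l. k < l) ?S"
    by (subst qsum_swap, rule qsum_cong) (simp add: add.commute)
  have S_eq: "qsum n (\<lambda>a k b l. k = l) ?S = dsum n (\<lambda>d m. (real d - 1) * g (int d))"
    unfolding qsum_multiplicities_eq by (rule dsum_cong) (auto simp: of_nat_diff)
  \<comment> \<open>The mirrored shift leaves \<open>a\<close> and \<open>l\<close> alone, and
    \<open>X\<close> depends only on these; the two regions cancel when both decompositions of
    \<open>X\<close> are compared.\<close>
  have X_greater: "qsum n (\<lambda>a k b l. a < b) X = qsum n (\<lambda>a k b l. l < k) X"
    unfolding qsum_shift' X_def by (rule qsum_cong) auto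
  have X_parts: "qsum n (\<lambda>a k b l. a = b) X = dsum n (\<lambda>d m. - (1 + (-1) ^ m) / 2 * g (int d))"
    unfolding qsum_parts_eq X_def
    by (rule dsum_cong) (simp add: sum_alternating_signs del: One_nat_def flip: sum_distrib_right)
  have X_mult: "qsum n (\<lambda>a k b l. k = l) X = dsum n (\<lambda>d m. (-1) ^ m * (\<Sum>a = 1..<d. g (int a)))"
    unfolding qsum_multiplicities_eq X_def by (simp add: sum_distrib_left)
  have "qsum n (\<lambda>a k b l. True) (\<lambda>a k b l. ?D a k b l - ?S a k b l) =
    2 * (qsum n (\<lambda>a k b l. k < l) X - qsum n (\<lambda>a k b l. b < a) X) - dsum n (\<lambda>d m. (real d - 1) * g (int d))"
    using qsum_split_parts[of n ?D] qsum_split_multiplicities[of n ?S]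
      D_less D_greater D_eq S_less S_greater S_eq by (simp add: qsum_linear)
  also have "qsum n (\<lambda>a k b l. k < l) X - qsum n (\<lambda>a k b l. b < a) X =
    qsum n (\<lambda>a k b l. a = b) X - qsum n (\<lambda>a k b l. k = l) X"
    using qsum_split_parts[of n X] qsum_split_multiplicities[of n X] X_greater by simp
  also have "2 * \<dots> - dsum n (\<lambda>d m. (real d - 1) * g (int d)) =
     dsum n (\<lambda>d m. 2 * (- (1 + (-1) ^ m) / 2 * g (int d) - (-1) ^ m * (\<Sum>a = 1..<d. g (int a))) - (real d - 1) * g (int d))"
    unfolding X_parts X_mult by (simp only: dsum_linear)
  also have "\<dots> = dsum n (\<lambda>d m. - ((real d + (-1) ^ m) * g (int d) + 2 * (-1) ^ m * (\<Sum>a = 1..<d. g (int a))))"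
    by (rule dsum_cong) (simp add: field_simps)
  finally show ?thesis by (simp add: right_diff_distrib dsum_linear)
qed

text \<open>Same scheme, but swapping the pairs changes the weight \<open>b\<close> into
  \<open>a\<close>, so the two halves of each sum combine into new summands \<open>V\<close> and
  \<open>W\<close> instead of doubling. The correction with \<open>h (int a)\<close> in the
  statement is \<open>V + W\<close>.\<close>

lemma liouville_odd:
  fixes h :: "int \<Rightarrow> real"
  assumes odd: "\<And>x. h (- x) = - h x"
  shows "qsum n (\<lambda>a k b l. True) (\<lambda>a k b l. (-1) ^ k * real b * (h (int a + int b) + h (int a - int b) - 2 * (1 - (-1) ^ l) * h (int a))) =
    dsum n (\<lambda>d m. real d * h (int d) / 2 + (-1) ^ m * (real d)\<^sup>2 * h (int d) / 2
      - (\<Sum>a = 1..<d. h (int a) * ((-1) ^ m * (real d - real a) - real d)))"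
proof -
  have zero: "h 0 = 0" using odd[of 0] by simp
  define V where "V = (\<lambda>(a::nat) (k::nat) (b::nat) (l::nat). ((-1) ^ k * real b + (-1) ^ (k + l) * (real a - real b)) * h (int a))"
  define W where "W = (\<lambda>(a::nat) (k::nat) (b::nat) (l::nat). ((-1) ^ k * real b - (-1) ^ (k + l) * (real a + real b)) * h (int a))"
  let ?D = "\<lambda>a k b l. (-1) ^ k * real b * h (int a - int b)"
  let ?S = "\<lambda>a k b l. (-1) ^ k * real b * h (int a + int b)"
  have S: "qsum n (\<lambda>a k b l. k < l) ?S + qsum n (\<lambda>a k b l. l < k) ?S = qsum n (\<lambda>a k b l. b < a) V"
  proof -
    have "qsum n (\<lambda>a k b l. l < k) ?S = qsum n (\<lambda>a k b l. k < l) (\<lambda>a k b l. (-1) ^ l * real a * h (int a + int b))"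
      by (subst qsum_swap) (simp add: add.commute)
    then have "qsum n (\<lambda>a k b l. k < l) ?S + qsum n (\<lambda>a k b l. l < k) ?S =
        qsum n (\<lambda>a k b l. k < l) (\<lambda>a k b l. ?S a k b l + (-1) ^ l * real a * h (int a + int b))"
      by (simp only: qsum_linear)
    also have "\<dots> = qsum n (\<lambda>a k b l. b < a) V"
      unfolding qsum_shift V_def by (rule qsum_cong) (simp add: algebra_simps)
    finally show ?thesis .
  qed
  have D: "qsum n (\<lambda>a k b l. b < a) ?D + qsum n (\<lambda>a k b l. a < b) ?D = qsum n (\<lambda>a k b l. k < l) W"
  proof -
    have "qsum n (\<lambda>a k b l. a < b) ?D = qsum n (\<lambda>a k b l. b < a) (\<lambda>a k b l. - ((-1) ^ l * real a * h (int a - int b)))"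
      by (subst qsum_swap, rule qsum_cong) (metis minus_diff_eq mult_minus_right odd)
    then have "qsum n (\<lambda>a k b l. b < a) ?D + qsum n (\<lambda>a k b l. a < b) ?D =
        qsum n (\<lambda>a k b l. b < a) (\<lambda>a k b l. ?D a k b l + - ((-1) ^ l * real a * h (int a - int b)))"
      by (simp only: qsum_linear)
    also have "\<dots> = qsum n (\<lambda>a k b l. k < l) W"
      unfolding qsum_shift W_def by (rule qsum_cong) (auto simp: algebra_simps minus_one_power_iff)
    finally show ?thesis .
  qed
  have D_eq: "qsum n (\<lambda>a k b l. a = b) ?D = 0"
    unfolding qsum_parts_eq dsum_def by (simp add: zero)
  \<comment> \<open>Because of this sign, \<open>V\<close> on \<open>b < a\<close> and
    \<open>W\<close> on \<open>k < l\<close> complete to the sum of \<open>V + W\<close> over all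
    quadruples, up to the diagonals.\<close>
  have V_greater: "qsum n (\<lambda>a k b l. a < b) V = - qsum n (\<lambda>a k b l. l < k) W"
    unfolding qsum_shift' V_def W_def qsum_linear(4)[symmetric]
    by (rule qsum_cong) (auto simp: algebra_simps minus_one_power_iff)
  have S_eq: "qsum n (\<lambda>a k b l. k = l) ?S = dsum n (\<lambda>d m. (-1) ^ m * (real d * (real d - 1) / 2) * h (int d))"
    unfolding qsum_multiplicities_eq
  proof (rule dsum_cong)
    fix d m :: nat assume "0 < d"
    have "(\<Sum>a = 1..<d. real (d - a)) = real d * (real d - 1) / 2"
    proof -
      have "(\<Sum>a = 1..<d. real (d - a)) = (\<Sum>a = 1..<d. real a)"
        by (rule sum.reindex_bij_witness[where i = "\<lambda>a. d - a" and j = "\<lambda>a. d - a"]) auto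
      also have "\<dots> = real d * (real d - 1) / 2"
        using \<open>0 < d\<close> by (induction d rule: nat_induct_non_zero) (auto simp: field_simps)
      finally show ?thesis .
    qed
    moreover have "(\<Sum>a = 1..<d. (-1) ^ m * real (d - a) * h (int a + int (d - a))) =
      (-1) ^ m * (\<Sum>a = 1..<d. real (d - a)) * h (int d)"
      unfolding sum_distrib_left sum_distrib_right by (rule sum.cong) auto
    ultimately show "(\<Sum>a = 1..<d. (-1) ^ m * real (d - a) * h (int a + int (d - a))) =
      (-1) ^ m * (real d * (real d - 1) / 2) * h (int d)" by simp
  qed
  have V_parts: "qsum n (\<lambda>a k b l. a = b) V = dsum n (\<lambda>d m. - (1 + (-1) ^ m) / 2 * real d * h (int d))"
    unfolding qsum_parts_eq V_def
  proof (rule dsum_cong)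
    fix d m :: nat assume "0 < m"
    have "(\<Sum>l = 1..<m. (-1) ^ (m - l)) = (\<Sum>l = 1..<m. (-1) ^ l :: real)"
      by (rule sum.reindex_bij_witness[where i = "\<lambda>a. m - a" and j = "\<lambda>a. m - a"]) auto
    then show "(\<Sum>l = 1..<m. ((-1) ^ (m - l) * real d + (-1) ^ (m - l + l) * (real d - real d)) * h (int d)) =
      - (1 + (-1) ^ m) / 2 * real d * h (int d)"
      using \<open>0 < m\<close> by (simp add: sum_alternating_signs del: One_nat_def flip: sum_distrib_right)
  qed
  have W_mult: "qsum n (\<lambda>a k b l. k = l) W = dsum n (\<lambda>d m. \<Sum>a = 1..<d. h (int a) * ((-1) ^ m * (real d - real a) - real d))"
    unfolding qsum_multiplicities_eq W_def
    by (intro dsum_cong sum.cong) (auto simp: of_nat_diff algebra_simps minus_one_power_iff)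
  have "qsum n (\<lambda>a k b l. True) (\<lambda>a k b l. ?S a k b l + ?D a k b l) =
    qsum n (\<lambda>a k b l. b < a) V + qsum n (\<lambda>a k b l. k < l) W + qsum n (\<lambda>a k b l. k = l) ?S"
    using qsum_split_parts[of n ?D] qsum_split_multiplicities[of n ?S] S D D_eq by (simp add: qsum_linear)
  also have "qsum n (\<lambda>a k b l. b < a) V + qsum n (\<lambda>a k b l. k < l) W =
    qsum n (\<lambda>a k b l. True) (\<lambda>a k b l. V a k b l + W a k b l)
     - qsum n (\<lambda>a k b l. a = b) V - qsum n (\<lambda>a k b l. k = l) W"
    using qsum_split_parts[of n V] qsum_split_multiplicities[of n W] V_greater by (simp add: qsum_linear)
  finally have *: "qsum n (\<lambda>a k b l. True) (\<lambda>a k b l. ?S a k b l + ?D a k b l) -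
      qsum n (\<lambda>a k b l. True) (\<lambda>a k b l. V a k b l + W a k b l) =
      qsum n (\<lambda>a k b l. k = l) ?S - qsum n (\<lambda>a k b l. a = b) V - qsum n (\<lambda>a k b l. k = l) W"
    by simp
  \<comment> \<open>Pointwise, \<open>V + W\<close> equals
    \<open>2 * (-1) ^ k * b * (1 - (-1) ^ l) * h a\<close>.\<close>
  have "qsum n (\<lambda>a k b l. True) (\<lambda>a k b l. (-1) ^ k * real b * (h (int a + int b) + h (int a - int b) - 2 * (1 - (-1) ^ l) * h (int a))) =
    qsum n (\<lambda>a k b l. True) (\<lambda>a k b l. (?S a k b l + ?D a k b l) - (V a k b l + W a k b l))"
    unfolding V_def W_def by (rule qsum_cong) (simp add: algebra_simps power_add)
  also have "\<dots> = dsum n (\<lambda>d m. (-1) ^ m * (real d * (real d - 1) / 2) * h (int d)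
     - (- (1 + (-1) ^ m) / 2 * real d * h (int d))
     - (\<Sum>a = 1..<d. h (int a) * ((-1) ^ m * (real d - real a) - real d)))"
    unfolding qsum_linear(2) * S_eq V_parts W_mult by (simp only: dsum_linear)
  also have "\<dots> = dsum n (\<lambda>d m. real d * h (int d) / 2 + (-1) ^ m * (real d)\<^sup>2 * h (int d) / 2
      - (\<Sum>a = 1..<d. h (int a) * ((-1) ^ m * (real d - real a) - real d)))"
    by (rule dsum_cong) (simp add: field_simps power2_eq_square)
  finally show ?thesis .
qed


text \<open>These evaluate the inner sums in Liouville's identities at
  \<open>(-1) ^ x * x ^ r\<close>: exponents 2, 4, 6 for the even functions, the pairs 1, 2 and 3, 4
  for the odd ones.\<close>

lemma alternating_power_sums:
  fixes d :: nat
  assumes "0 < d"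
  shows "(\<Sum>a = 1..<d. (-1) ^ a * real a ^ 1) = - ((-1) ^ d * (2 * real d - 1) + 1) / 4"
    and "(\<Sum>a = 1..<d. (-1) ^ a * real a ^ 2) = - ((-1) ^ d * (real d ^ 2 - real d)) / 2"
    and "(\<Sum>a = 1..<d. (-1) ^ a * real a ^ 3) = - ((-1) ^ d * (4 * real d ^ 3 - 6 * real d ^ 2 + 1) - 1) / 8"
    and "(\<Sum>a = 1..<d. (-1) ^ a * real a ^ 4) = - ((-1) ^ d * (real d ^ 4 - 2 * real d ^ 3 + real d)) / 2"
    and "(\<Sum>a = 1..<d. (-1) ^ a * real a ^ 6) = - ((-1) ^ d * (real d ^ 6 - 3 * real d ^ 5 + 5 * real d ^ 3 - 3 * real d)) / 2"
  using assms
  by (induction d rule: nat_induct_non_zero; simp; simp add: field_simps eval_nat_numeral)+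

subsection \<open>Relations between divisor series\<close>

definition U :: "nat \<Rightarrow> real fps" where
  "U r = lambert (\<lambda>a k. (-1) ^ (a + k) * real a ^ r)"

definition G :: "nat \<Rightarrow> real fps" where
  "G r = lambert (\<lambda>a k. (-1) ^ a * real a ^ r)"

text \<open>
  \<open>H = G 1 - 2 L\<close> with \<open>L\<close> the sum of the divisors \<open>d\<close> of \<open>n\<close> with \<open>n / d\<close> odd; the two series only
  occur in this combination, which is eliminated later.
\<close>
definition H :: "real fps" where
  "H = lambert (\<lambda>a k. real a * ((-1) ^ a - 1 + (-1) ^ k))"

lemma dsum_zero: "dsum 0 F = 0"
  unfolding dsum_def by (rule sum.neutral) auto

lemma lambert_nth: "fps_nth (lambert F) n = dsum n F"
  by (simp add: lambert_def)

lemma numeral_mult_nth: "fps_nth (numeral c * f) n = numeral c * fps_nth (f :: real fps) n"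
  by (metis fps_mult_left_const_nth numeral_fps_const)

text \<open>These are the instances \<open>r = 2, 4, 6\<close> of \<open>liouville_even\<close>. In
  \<open>(a - b) ^ r - (a + b) ^ r\<close> only monomials odd in both \<open>a\<close> and
  \<open>b\<close> survive, which gives products of the series \<open>U\<close> with odd
  index.\<close>

lemma U_even_relations:
  shows "4 * (U 1 * U 1) = G 3 + U 1"
    and "16 * (U 1 * U 3) = G 5 + 2 * U 3 - U 1"
    and "24 * (U 1 * U 5) + 40 * (U 3 * U 3) = G 7 + 3 * U 5 - 5 * U 3 + 3 * U 1"
proof -
  \<comment> \<open>The case distinction is \<open>(-1) ^ x\<close> for an integer
    \<open>x\<close>.\<close>
  let ?g = "\<lambda>r x :: int. (if even x then 1 else - 1 :: real) * real_of_int x ^ r"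
  have sum_g: "(\<Sum>a = 1..<d. ?g r (int a)) = (\<Sum>a = 1..<d. (-1) ^ a * real a ^ r)" for d r
    by (rule sum.cong) auto
  show "4 * (U 1 * U 1) = G 3 + U 1"
  proof (rule fps_ext)
    fix n
    have "- 4 * fps_nth (U 1 * U 1) n = qsum n (\<lambda>a k b l. True) (\<lambda>a k b l. (-1) ^ (k + l) * (?g 2 (int a - int b) - ?g 2 (int a + int b)))"
      unfolding U_def lambert_mult_nth qsum_linear(3)[symmetric]
      by (rule qsum_cong) (auto simp: minus_one_power_iff algebra_simps power2_eq_square)
    also have "\<dots> = - dsum n (\<lambda>d m. (real d + (-1) ^ m) * ?g 2 (int d) + 2 * (-1) ^ m * (\<Sum>a = 1..<d. ?g 2 (int a)))"
      by (rule liouville_even) auto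
    \<comment> \<open>The inner alternating sum cancels the term
      \<open>(-1) ^ (d + m) * d ^ 2\<close>, so only odd powers of \<open>d\<close> remain; likewise
      for exponents 4 and 6 below.\<close>
    also have "\<dots> = - dsum n (\<lambda>d m. (-1) ^ d * real d ^ 3 + (-1) ^ (d + m) * real d ^ 1)"
      unfolding sum_g
      by (intro arg_cong[where f = uminus] dsum_cong)
         (simp only: alternating_power_sums, simp add: minus_one_power_iff, simp add: field_simps eval_nat_numeral)
    finally show "fps_nth (4 * (U 1 * U 1)) n = fps_nth (G 3 + U 1) n"
      by (simp add: U_def G_def lambert_nth dsum_linear numeral_mult_nth)
  qed
  show "16 * (U 1 * U 3) = G 5 + 2 * U 3 - U 1"
  proof (rule fps_ext)
    fix n
    have "- 8 * fps_nth (U 1 * U 3) n + - 8 * fps_nth (U 3 * U 1) n =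
      qsum n (\<lambda>a k b l. True) (\<lambda>a k b l. (-1) ^ (k + l) * (?g 4 (int a - int b) - ?g 4 (int a + int b)))"
      unfolding U_def lambert_mult_nth qsum_linear(1,3)[symmetric]
      by (rule qsum_cong) (simp add: minus_one_power_iff, simp add: algebra_simps eval_nat_numeral)
    also have "\<dots> = - dsum n (\<lambda>d m. (real d + (-1) ^ m) * ?g 4 (int d) + 2 * (-1) ^ m * (\<Sum>a = 1..<d. ?g 4 (int a)))"
      by (rule liouville_even) auto
    also have "\<dots> = - dsum n (\<lambda>d m. (-1) ^ d * real d ^ 5 + 2 * ((-1) ^ (d + m) * real d ^ 3) - (-1) ^ (d + m) * real d ^ 1)"
      unfolding sum_g
      by (intro arg_cong[where f = uminus] dsum_cong)
         (simp only: alternating_power_sums, simp add: minus_one_power_iff, simp add: field_simps eval_nat_numeral)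
    finally show "fps_nth (16 * (U 1 * U 3)) n = fps_nth (G 5 + 2 * U 3 - U 1) n"
      by (simp add: U_def G_def lambert_nth dsum_linear numeral_mult_nth mult.commute[of "lambert (\<lambda>a k. (-1) ^ (a + k) * real a ^ 3)"])
  qed
  show "24 * (U 1 * U 5) + 40 * (U 3 * U 3) = G 7 + 3 * U 5 - 5 * U 3 + 3 * U 1"
  proof (rule fps_ext)
    fix n
    \<comment> \<open>\<open>(a - b) ^ 6 - (a + b) ^ 6 = - 12 * a ^ 5 * b - 40 * a ^ 3 * b ^ 3 - 12
      * a * b ^ 5\<close>.\<close>
    have "- 12 * fps_nth (U 1 * U 5) n + - 12 * fps_nth (U 5 * U 1) n + - 40 * fps_nth (U 3 * U 3) n =
      qsum n (\<lambda>a k b l. True) (\<lambda>a k b l. (-1) ^ (k + l) * (?g 6 (int a - int b) - ?g 6 (int a + int b)))"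
      unfolding U_def lambert_mult_nth qsum_linear(1,3)[symmetric]
      by (rule qsum_cong) (simp add: minus_one_power_iff, simp add: algebra_simps eval_nat_numeral)
    also have "\<dots> = - dsum n (\<lambda>d m. (real d + (-1) ^ m) * ?g 6 (int d) + 2 * (-1) ^ m * (\<Sum>a = 1..<d. ?g 6 (int a)))"
      by (rule liouville_even) auto
    also have "\<dots> = - dsum n (\<lambda>d m. (-1) ^ d * real d ^ 7 + 3 * ((-1) ^ (d + m) * real d ^ 5)
        - 5 * ((-1) ^ (d + m) * real d ^ 3) + 3 * ((-1) ^ (d + m) * real d ^ 1))"
      unfolding sum_g
      by (intro arg_cong[where f = uminus] dsum_cong)
         (simp only: alternating_power_sums, simp add: minus_one_power_iff, simp add: field_simps eval_nat_numeral)
    finally show "fps_nth (24 * (U 1 * U 5) + 40 * (U 3 * U 3)) n = fps_nth (G 7 + 3 * U 5 - 5 * U 3 + 3 * U 1) n"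
      by (simp add: U_def G_def lambert_nth dsum_linear numeral_mult_nth mult.commute[of "lambert (\<lambda>a k. (-1) ^ (a + k) * real a ^ 5)"])
  qed
qed

text \<open>These are the instances \<open>r = 1, 3\<close> of \<open>liouville_odd\<close>. After
  the correction term, the factor left beside \<open>2 * (-1) ^ (a + k) * a ^ r\<close> is
  \<open>b * ((-1) ^ b - 1 + (-1) ^ l)\<close>, the summand of \<open>H\<close>. For
  \<open>r = 3\<close> the extra monomial \<open>6 * a * b ^ 2\<close>, times the weight
  \<open>b\<close>, yields \<open>U 1 * G 3\<close>.\<close>

lemma U_odd_relations:
  shows "8 * (U 1 * H) = 2 * U 3 + U 1 + H"
    and "16 * (U 3 * H) + 48 * (U 1 * G 3) = 4 * U 5 + 6 * G 3 + 2 * U 3 - H - 3 * U 1"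
proof -
  let ?h = "\<lambda>r x :: int. (if even x then 1 else - 1 :: real) * real_of_int x ^ r"
  \<comment> \<open>Here \<open>e\<close> stands for \<open>(-1) ^ m\<close>. The exponent
    \<open>s\<close> is a separate variable so that numerals can be inserted for it.\<close>
  have sum_h: "(\<Sum>a = 1..<d. ?h r (int a) * (e * (real d - real a) - real d)) =
      (e - 1) * real d * (\<Sum>a = 1..<d. (-1) ^ a * real a ^ r) - e * (\<Sum>a = 1..<d. (-1) ^ a * real a ^ s)" if "s = r + 1" for d r s e
    unfolding sum_distrib_left sum_subtractf[symmetric] that
    by (rule sum.cong) (auto simp: algebra_simps)
  have four: "4 = 3 + (1::nat)" by simp
  show "8 * (U 1 * H) = 2 * U 3 + U 1 + H"
  proof (rule fps_ext)
    fix n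
    have "2 * fps_nth (U 1 * H) n = qsum n (\<lambda>a k b l. True) (\<lambda>a k b l. (-1) ^ k * real b *
        (?h 1 (int a + int b) + ?h 1 (int a - int b) - 2 * (1 - (-1) ^ l) * ?h 1 (int a)))"
      unfolding U_def H_def lambert_mult_nth qsum_linear(3)[symmetric]
      by (rule qsum_cong) (auto simp: minus_one_power_iff algebra_simps)
    also have "\<dots> = dsum n (\<lambda>d m. real d * ?h 1 (int d) / 2 + (-1) ^ m * (real d)\<^sup>2 * ?h 1 (int d) / 2
      - (\<Sum>a = 1..<d. ?h 1 (int a) * ((-1) ^ m * (real d - real a) - real d)))"
      by (rule liouville_odd) auto
    also have "\<dots> = dsum n (\<lambda>d m. 1 / 2 * ((-1) ^ (d + m) * real d ^ 3) + 1 / 4 * ((-1) ^ (d + m) * real d ^ 1)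
        + 1 / 4 * (real d * ((-1) ^ d - 1 + (-1) ^ m)))"
      unfolding sum_h[of 2 1, OF one_add_one[symmetric]]
      by (intro dsum_cong)
         (simp only: alternating_power_sums, simp add: minus_one_power_iff, simp add: field_simps eval_nat_numeral)
    finally show "fps_nth (8 * (U 1 * H)) n = fps_nth (2 * U 3 + U 1 + H) n"
      unfolding dsum_linear
      by (simp add: U_def H_def lambert_nth numeral_mult_nth)
  qed
  show "16 * (U 3 * H) + 48 * (U 1 * G 3) = 4 * U 5 + 6 * G 3 + 2 * U 3 - H - 3 * U 1"
  proof (rule fps_ext)
    fix n
    have "2 * fps_nth (U 3 * H) n + 6 * fps_nth (U 1 * G 3) n = qsum n (\<lambda>a k b l. True) (\<lambda>a k b l. (-1) ^ k * real b *
        (?h 3 (int a + int b) + ?h 3 (int a - int b) - 2 * (1 - (-1) ^ l) * ?h 3 (int a)))"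
      unfolding U_def G_def H_def lambert_mult_nth qsum_linear(1,3)[symmetric]
      by (rule qsum_cong) (simp add: minus_one_power_iff, simp add: algebra_simps eval_nat_numeral)
    also have "\<dots> = dsum n (\<lambda>d m. real d * ?h 3 (int d) / 2 + (-1) ^ m * (real d)\<^sup>2 * ?h 3 (int d) / 2
      - (\<Sum>a = 1..<d. ?h 3 (int a) * ((-1) ^ m * (real d - real a) - real d)))"
      by (rule liouville_odd) auto
    also have "\<dots> = dsum n (\<lambda>d m. 1 / 2 * ((-1) ^ (d + m) * real d ^ 5) + 3 / 4 * ((-1) ^ d * real d ^ 3)
        + 1 / 4 * ((-1) ^ (d + m) * real d ^ 3) - 1 / 8 * (real d * ((-1) ^ d - 1 + (-1) ^ m))
        - 3 / 8 * ((-1) ^ (d + m) * real d ^ 1))"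
      unfolding sum_h[OF four]
      by (intro dsum_cong)
         (simp only: alternating_power_sums, simp add: minus_one_power_iff, simp add: field_simps eval_nat_numeral)
    finally show "fps_nth (16 * (U 3 * H) + 48 * (U 1 * G 3)) n = fps_nth (4 * U 5 + 6 * G 3 + 2 * U 3 - H - 3 * U 1) n"
      unfolding dsum_linear
      by (simp add: U_def G_def H_def lambert_nth numeral_mult_nth)
  qed
qed

section \<open>Elimination of the auxiliary series\<close>

lemma fourth_power_relation:
  "3 * (1 - 8 * U 1) ^ 4 = 3 - 32 * (U 1 + U 3 + U 5) + 256 * (U 1 * U 5 - U 3 * U 3)"
proof -
  have "(8 * U 1 - 1) * H = 2 * U 3 + U 1"
    using U_odd_relations(1) by (simp add: algebra_simps)
  moreover have "(16 * U 3 + 1) * H = 4 * U 5 + 6 * G 3 + 2 * U 3 - 3 * U 1 - 48 * (U 1 * G 3)"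
    using U_odd_relations(2) by (simp add: algebra_simps)
  moreover have "G 3 = 4 * (U 1 * U 1) - U 1"
    using U_even_relations(1) by simp
  \<comment> \<open>Cross-multiplying the first two equations removes \<open>H\<close> without
    division. With \<open>v = 1 - 8 * U 1\<close> the third one says
    \<open>16 * G 3 = v ^ 2 - 1\<close>, and the fourth power comes from the product
    \<open>v ^ 2 * G 3\<close>.\<close>
  ultimately show ?thesis by algebra
qed

text \<open>\<open>U 5\<close> enters both \<open>G 7\<close> and
  \<open>fourth_power_relation\<close> only through \<open>(1 - 8 * U 1) * U 5\<close> and can
  therefore be eliminated; in the remaining polynomial in \<open>U 1\<close> and \<open>U 3\<close>
  all terms with \<open>U 3\<close> cancel.\<close>

lemma sixth_power_relation:
  "9 * (1 - 8 * U 1) ^ 6 = 9 + 16 * (17 * G 3 + 8 * G 5 + 2 * G 7) + 512 * (G 3 * G 7 - G 5 * G 5)"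
proof -
  have "G 3 = 4 * (U 1 * U 1) - U 1" "G 5 = 16 * (U 1 * U 3) - 2 * U 3 + U 1"
    "G 7 = 24 * (U 1 * U 5) + 40 * (U 3 * U 3) - 3 * U 5 + 5 * U 3 - 3 * U 1"
    using U_even_relations by simp_all
  then show ?thesis using fourth_power_relation by algebra
qed


subsection \<open>Jacobi's four-square theorem\<close>

text \<open>The modulus will be 1 or 2: in the product of \<open>U 1\<close> and
  \<open>theta\<close>, triples with \<open>a\<close> and \<open>b\<close> both even carry the
  opposite sign and must be summed separately.\<close>

definition triples :: "int \<Rightarrow> int \<Rightarrow> (int \<times> int \<times> int) set" where
  "triples m n = {(x, a, b). 0 < a \<and> 0 < b \<and> m dvd a \<and> m dvd b \<and> x\<^sup>2 + a * b = n}"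

lemma abs_le_square_int: "\<bar>x\<bar> \<le> x\<^sup>2" for x :: int
proof (cases "x = 0")
  case False
  then have "\<bar>x\<bar> * 1 \<le> \<bar>x\<bar> * \<bar>x\<bar>"
    by (intro mult_left_mono) linarith+
  then show ?thesis by (simp add: power2_eq_square)
qed simp

lemma finite_squares: "finite {x :: int. x\<^sup>2 = n}"
proof (rule finite_subset)
  show "{x :: int. x\<^sup>2 = n} \<subseteq> {- n..n}"
  proof
    fix x assume "x \<in> {x :: int. x\<^sup>2 = n}"
    then show "x \<in> {- n..n}" using abs_le_square_int[of x] by auto
  qed
qed simp

lemma finite_triples: "finite (triples m n)"
proof (rule finite_subset)
  show "triples m n \<subseteq> {- n..n} \<times> {0..n} \<times> {0..n}"
  proof
    fix p assume "p \<in> triples m n"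
    then obtain x a b where p: "p = (x, a, b)" "0 < a" "0 < b" "x\<^sup>2 + a * b = n"
      by (auto simp: triples_def)
    have "a \<le> a * b" "b \<le> a * b" "0 \<le> x\<^sup>2"
      using p by simp_all
    then have "- n \<le> x" "x \<le> n" "a \<le> n" "b \<le> n"
      using p(2-4) abs_le_square_int[of x] by linarith+
    then show "p \<in> {- n..n} \<times> {0..n} \<times> {0..n}"
      using p(1-3) by simp
  qed
qed simp

text \<open>Symmetrizing the summand in \<open>a\<close> and \<open>b\<close> and adding a term odd
  in \<open>x\<close> gives the cubic form \<open>\<phi>\<close>. Its sum vanishes on either side of
  the boundary \<open>b = a + 2 * x\<close>, so only the boundary contributes.\<close>

lemma sum_triples:
  assumes "m dvd 2"
  shows "2 * (\<Sum>(x, a, b) \<in> triples m n. a * (a * b - 4 * x\<^sup>2)) =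
    (\<Sum>(x, a, b) \<in> {(x, a, b) \<in> triples m n. b = a + 2 * x}. (a + b) * (a * b))"
proof -
  define \<phi> where "\<phi> = (\<lambda>(x :: int, a :: int, b :: int). (a + b) * (a * b - 4 * x\<^sup>2 - 2 * (a - b) * x))"
  let ?S = "triples m n"
  let ?T = "{(x, a, b) \<in> ?S. b < a + 2 * x}"
  let ?C = "{(x, a, b) \<in> ?S. a + 2 * x < b}"
  let ?B = "{(x, a, b) \<in> ?S. b = a + 2 * x}"
  have dvd: "m dvd 2 * x" for x
    using assms by (rule dvd_mult2)
  then have dvd': "m dvd x * 2" for x
    by (simp add: mult.commute)
  have fin: "finite ?T" "finite ?C" "finite ?B"
    by (rule finite_subset[OF _ finite_triples[of m n]]; auto)+
  \<comment> \<open>The involution preserves \<open>x\<^sup>2 + a * b\<close>. It maps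
    \<open>?T\<close> to itself because the new value of \<open>a + 2 * x - b\<close> is the old
    \<open>a\<close>; divisibility survives since \<open>m\<close> divides
    \<open>2 * x\<close>.\<close>
  have "sum \<phi> ?T = (\<Sum>p \<in> ?T. - \<phi> p)"
    by (rule sum.reindex_bij_witness[where i = "\<lambda>(x, a, b). (b - x, a + 2 * x - b, b)"
          and j = "\<lambda>(x, a, b). (b - x, a + 2 * x - b, b)"])
       (auto simp: triples_def \<phi>_def power2_eq_square algebra_simps intro!: dvd_diff dvd_add dvd')
  then have T: "sum \<phi> ?T = 0"
    by (simp add: sum_negf)
  \<comment> \<open>This reflection exchanges the two sides of the boundary and fixes
    \<open>\<phi>\<close>.\<close>
  have C: "sum \<phi> ?C = sum \<phi> ?T"
    by (rule sum.reindex_bij_witness[where i = "\<lambda>(x, a, b). (- x, b, a)" and j = "\<lambda>(x, a, b). (- x, b, a)"])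
       (auto simp: triples_def \<phi>_def algebra_simps)
  have "?S = (?T \<union> ?C) \<union> ?B" by auto
  then have "sum \<phi> ?S = sum \<phi> ((?T \<union> ?C) \<union> ?B)" by simp
  also have "\<dots> = sum \<phi> ?T + sum \<phi> ?C + sum \<phi> ?B"
    using fin by (subst sum.union_disjoint, auto)+
  finally have S: "sum \<phi> ?S = sum \<phi> ?B"
    using T C by simp
  have "(\<Sum>(x, a, b) \<in> ?S. (a + b) * (a - b) * x) = (\<Sum>(x, a, b) \<in> ?S. - ((a + b) * (a - b) * x))"
    by (rule sum.reindex_bij_witness[where i = "\<lambda>(x, a, b). (- x, a, b)" and j = "\<lambda>(x, a, b). (- x, a, b)"])
       (auto simp: triples_def)
  then have linear: "(\<Sum>(x, a, b) \<in> ?S. (a + b) * (a - b) * x) = 0"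
    by (simp add: sum_negf case_prod_unfold)
  have swap: "(\<Sum>(x, a, b) \<in> ?S. b * (a * b - 4 * x\<^sup>2)) = (\<Sum>(x, a, b) \<in> ?S. a * (a * b - 4 * x\<^sup>2))"
    by (rule sum.reindex_bij_witness[where i = "\<lambda>(x, a, b). (x, b, a)" and j = "\<lambda>(x, a, b). (x, b, a)"])
       (auto simp: triples_def algebra_simps)
  have "sum \<phi> ?S = (\<Sum>(x, a, b) \<in> ?S. a * (a * b - 4 * x\<^sup>2)) + (\<Sum>(x, a, b) \<in> ?S. b * (a * b - 4 * x\<^sup>2))
      - 2 * (\<Sum>(x, a, b) \<in> ?S. (a + b) * (a - b) * x)"
    unfolding \<phi>_def sum_distrib_left sum.distrib[symmetric] sum_subtractf[symmetric]
    by (rule sum.cong) (auto simp: algebra_simps)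
  \<comment> \<open>On the boundary \<open>a - b = - 2 * x\<close>, so the terms of
    \<open>\<phi>\<close> containing \<open>x\<close> cancel.\<close>
  moreover have "sum \<phi> ?B = (\<Sum>(x, a, b) \<in> ?B. (a + b) * (a * b))"
    by (rule sum.cong) (auto simp: \<phi>_def algebra_simps power2_eq_square)
  ultimately show ?thesis
    using S swap linear by simp
qed

lemma sum_parabola:
  "6 * (\<Sum>a = 1..<t. int a * (c - int a)) = 3 * c * int t * (int t - 1) - (int t - 1) * int t * (2 * int t - 1)"
proof (induction t)
  case (Suc t)
  then show ?case by (cases "t = 0") (auto simp: algebra_simps)
qed simp

text \<open>On the boundary \<open>x\<^sup>2 + a * b = (x + a)\<^sup>2\<close> with
  \<open>x + a > 0\<close>, hence \<open>x = s - a\<close> and \<open>a + b = 2 * s\<close>. So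
  \<open>a\<close> runs through the multiples of \<open>m\<close> strictly between 0 and
  \<open>m * t\<close>.\<close>

lemma sum_triples_square:
  assumes "int m dvd 2" "0 < m" and t: "m * t = 2 * s"
  shows "6 * (\<Sum>(x, a, b) \<in> triples (int m) (int (s\<^sup>2)). a * (a * b - 4 * x\<^sup>2)) = int s * int m ^ 2 * (int t ^ 3 - int t)"
proof -
  let ?B = "{(x, a, b) \<in> triples (int m) (int (s\<^sup>2)). b = a + 2 * x}"
  have mt: "int m * int t = 2 * int s"
    using t by (metis of_nat_mult of_nat_numeral)
  have "(\<Sum>(x, a, b) \<in> ?B. (a + b) * (a * b)) = (\<Sum>a = 1..<t. 2 * int s * (int m * int a) * (int m * int t - int m * int a))"
  proof (rule sum.reindex_bij_witness[where i = "\<lambda>a. (int s - int m * int a, int m * int a, int m * (int t - int a))"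
        and j = "\<lambda>(x, a, b). nat (a div int m)"])
    fix p assume "p \<in> ?B"
    then obtain x a b where p: "p = (x, a, b)" "0 < a" "0 < b" "int m dvd a" "b = a + 2 * x" "x\<^sup>2 + a * b = int (s\<^sup>2)"
      by (auto simp: triples_def)
    from p(4) obtain c where c: "a = int m * c" by (elim dvdE)
    have "0 < c" using p(2) c \<open>0 < m\<close> by (simp add: zero_less_mult_iff)
    have "(x + a)\<^sup>2 = (int s)\<^sup>2"
      using p(5,6) by (simp add: power2_eq_square algebra_simps)
    moreover have "0 < x + a" using p(2,3,5) by linarith
    ultimately have x: "x = int s - a"
      by (metis add_diff_cancel_right' less_imp_le of_nat_0_le_iff power2_eq_imp_eq)
    have b: "b = int m * (int t - c)"
      using p(5) x c mt by (simp add: algebra_simps)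
    then have "c < int t" using p(3) \<open>0 < m\<close> by (simp add: zero_less_mult_iff)
    have j: "nat (a div int m) = nat c" using c \<open>0 < m\<close> by simp
    show "(\<lambda>a. (int s - int m * int a, int m * int a, int m * (int t - int a))) ((\<lambda>(x, a, b). nat (a div int m)) p) = p"
      using p(1) x b c j \<open>0 < c\<close> by simp
    show "(\<lambda>(x, a, b). nat (a div int m)) p \<in> {1..<t}"
      using p(1) j \<open>0 < c\<close> \<open>c < int t\<close> by auto
    show "2 * int s * (int m * int ((\<lambda>(x, a, b). nat (a div int m)) p)) * (int m * int t - int m * int ((\<lambda>(x, a, b). nat (a div int m)) p)) =
      (case p of (x, a, b) \<Rightarrow> (a + b) * (a * b))"
      using p(1) x b c j \<open>0 < c\<close> mt by (simp add: algebra_simps)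
  next
    fix a assume a: "a \<in> {1..<t}"
    then show "(\<lambda>(x, a, b). nat (a div int m)) (int s - int m * int a, int m * int a, int m * (int t - int a)) = a"
      using \<open>0 < m\<close> by simp
    have "(int s - int m * int a)\<^sup>2 + int m * int a * (int m * (int t - int a)) = (int s)\<^sup>2"
      using mt by algebra
    moreover have "int m * (int t - int a) = int m * int a + 2 * (int s - int m * int a)"
      using mt by algebra
    moreover have "0 < int m * int a" "0 < int m * (int t - int a)"
      using a \<open>0 < m\<close> by simp_all
    ultimately show "(int s - int m * int a, int m * int a, int m * (int t - int a)) \<in> ?B"
      unfolding triples_def mem_Collect_eq case_prod_conv of_nat_power by (blast intro: dvd_triv_left)
  qed
  also have "\<dots> = 2 * int s * int m ^ 2 * (\<Sum>a = 1..<t. int a * (int t - int a))"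
    unfolding sum_distrib_left by (rule sum.cong) (auto simp: algebra_simps power2_eq_square)
  finally have "(\<Sum>(x, a, b) \<in> triples (int m) (int (s\<^sup>2)). a * (a * b - 4 * x\<^sup>2)) =
      int s * int m ^ 2 * (\<Sum>a = 1..<t. int a * (int t - int a))"
    using sum_triples[OF assms(1), of "int (s\<^sup>2)"] by simp
  then show ?thesis
    using sum_parabola[of "int t" t] by algebra
qed

lemma square_int_eq_nat:
  fixes x :: int
  assumes "x\<^sup>2 = int n"
  shows "n = (nat \<bar>x\<bar>)\<^sup>2"
proof -
  have "int n = int ((nat \<bar>x\<bar>)\<^sup>2)" using assms by simp
  then show ?thesis by (simp only: of_nat_eq_iff)
qed

lemma sum_triples_nonsquare:
  assumes "m dvd 2" and nonsquare: "\<And>s. n \<noteq> s\<^sup>2"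
  shows "(\<Sum>(x, a, b) \<in> triples m (int n). a * (a * b - 4 * x\<^sup>2)) = 0"
proof -
  have "{(x, a, b) \<in> triples m (int n). b = a + 2 * x} = {}"
  proof -
    have False if "x\<^sup>2 + a * (a + 2 * x) = int n" for x a :: int
    proof -
      have "(x + a)\<^sup>2 = int n" using that by (simp add: power2_eq_square algebra_simps)
      then show False using nonsquare square_int_eq_nat by blast
    qed
    then show ?thesis by (auto simp: triples_def)
  qed
  then have "2 * (\<Sum>(x, a, b) \<in> triples m (int n). a * (a * b - 4 * x\<^sup>2)) = 0"
    unfolding sum_triples[OF assms(1)] by (simp only: sum.empty)
  then show ?thesis by simp
qed

text \<open>For \<open>n = x\<^sup>2\<close> the sign \<open>(-1) ^ n\<close> is
  \<open>(-1) ^ x\<close>: this is the classical theta series at \<open>- q\<close>.\<close>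

definition theta :: "real fps" where
  "theta = Abs_fps (\<lambda>n. (-1) ^ n * real (card {x :: int. x\<^sup>2 = int n}))"

lemma theta_nth: "fps_nth theta n = (-1) ^ n * real (card {x :: int. x\<^sup>2 = int n})"
  by (simp add: theta_def)

text \<open>With \<open>i = a * b\<close> and \<open>n = x\<^sup>2 + a * b\<close> the weight
  \<open>5 * i - 4 * n\<close> is \<open>a * b - 4 * x\<^sup>2\<close>, the factor in
  \<open>sum_triples\<close>.\<close>

lemma U1_theta_convolution:
  "(\<Sum>i = 0..n. (5 * real i - 4 * real n) * fps_nth (U 1) i * fps_nth theta (n - i)) =
    (-1) ^ n * real_of_int (2 * (\<Sum>(x, a, b) \<in> triples 2 (int n). a * (a * b - 4 * x\<^sup>2))
      - (\<Sum>(x, a, b) \<in> triples 1 (int n). a * (a * b - 4 * x\<^sup>2)))"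
proof -
  let ?P = "\<lambda>i. {(d, m). 0 < d \<and> 0 < m \<and> d * m = (i :: nat)}"
  let ?Q = "\<lambda>i. {x :: int. x\<^sup>2 = int i}"
  define f where "f = (\<lambda>(x :: int, a :: int, b :: int). a * (a * b - 4 * x\<^sup>2))"
  let ?e = "\<lambda>(x :: int, a :: int, b :: int). if even a \<and> even b then 1 else - 1 :: int"
  have "(\<Sum>i = 0..n. (5 * real i - 4 * real n) * fps_nth (U 1) i * fps_nth theta (n - i)) =
    (\<Sum>i = 0..n. \<Sum>(p, x) \<in> ?P i \<times> ?Q (n - i). (5 * real i - 4 * real n) * (-1) ^ (fst p + snd p) * real (fst p) * (-1) ^ (n - i))"
    unfolding sum.cartesian_product[symmetric]
    by (simp add: U_def lambert_nth dsum_def theta_nth case_prod_unfold sum_distrib_left sum_distrib_right mult_ac)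
  also have "\<dots> = (\<Sum>(i, p, x) \<in> (SIGMA i:{0..n}. ?P i \<times> ?Q (n - i)).
      (5 * real i - 4 * real n) * (-1) ^ (fst p + snd p) * real (fst p) * (-1) ^ (n - i))"
    by (subst sum.Sigma) (auto simp: finite_divisor_pairs[unfolded case_prod_unfold] finite_squares case_prod_unfold)
  also have "\<dots> = (\<Sum>p \<in> triples 1 (int n). (-1) ^ n * real_of_int (?e p * f p))"
  proof (rule sum.reindex_bij_witness[where i = "\<lambda>(x, a, b). (nat (a * b), (nat a, nat b), x)"
        and j = "\<lambda>(i, (a, b), x). (x, int a, int b)"])
    fix q assume "q \<in> (SIGMA i:{0..n}. ?P i \<times> ?Q (n - i))"
    then obtain a b x where q: "q = (a * b, (a, b), x)" "0 < a" "0 < b" "a * b \<le> n" "x\<^sup>2 = int (n - a * b)"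
      by auto
    show "(\<lambda>(x, a, b). (nat (a * b), (nat a, nat b), x)) ((\<lambda>(i, (a, b), x). (x, int a, int b)) q) = q"
      using q by (simp add: nat_mult_distrib)
    show "(\<lambda>(i, (a, b), x). (x, int a, int b)) q \<in> triples 1 (int n)"
      using q by (simp add: triples_def of_nat_diff)
    have "int n = x\<^sup>2 + int a * int b" using q by (simp add: of_nat_diff)
    then have "real n = real_of_int (x\<^sup>2 + int a * int b)" by (metis of_int_of_nat_eq)
    then have coeff: "5 * real (a * b) - 4 * real n = real a * real b - 4 * (real_of_int x)\<^sup>2"
      by simp
    \<comment> \<open>\<open>a + b + a * b = (a + 1) * (b + 1) - 1\<close> is even exactly when
      \<open>a\<close> and \<open>b\<close> are both even.\<close>
    have sign: "(-1) ^ (a + b) * (-1) ^ (n - a * b) = (-1) ^ n * (if even a \<and> even b then 1 else - 1 :: real)"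
      using \<open>a * b \<le> n\<close> by (auto simp: minus_one_power_iff)
    have "(5 * real (a * b) - 4 * real n) * (-1) ^ (a + b) * real a * (-1) ^ (n - a * b) =
        (5 * real (a * b) - 4 * real n) * real a * ((-1) ^ (a + b) * (-1) ^ (n - a * b))"
      by (simp only: mult_ac)
    also have "\<dots> = (-1) ^ n * (if even a \<and> even b then 1 else - 1 :: real) * (real a * (real a * real b - 4 * (real_of_int x)\<^sup>2))"
      unfolding coeff sign by (simp only: mult_ac)
    also have "\<dots> = (-1) ^ n * real_of_int (?e (x, int a, int b) * f (x, int a, int b))"
      by (simp add: f_def)
    finally show "(-1) ^ n * real_of_int (?e ((\<lambda>(i, (a, b), x). (x, int a, int b)) q) * f ((\<lambda>(i, (a, b), x). (x, int a, int b)) q)) =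
      (case q of (i, p, x) \<Rightarrow> (5 * real i - 4 * real n) * (-1) ^ (fst p + snd p) * real (fst p) * (-1) ^ (n - i))"
      unfolding q(1) by (simp only: case_prod_conv fst_conv snd_conv)
  next
    fix p assume "p \<in> triples 1 (int n)"
    then obtain x a b where p: "p = (x, a, b)" "0 < a" "0 < b" "x\<^sup>2 + a * b = int n"
      by (auto simp: triples_def)
    show "(\<lambda>(i, (a, b), x). (x, int a, int b)) ((\<lambda>(x, a, b). (nat (a * b), (nat a, nat b), x)) p) = p"
      using p by simp
    have "0 \<le> x\<^sup>2" by simp
    then have "a * b \<le> int n" using p(4) by linarith
    then have "nat (a * b) \<le> n" by linarith
    have ab: "nat a * nat b = nat (a * b)" using p by (simp add: nat_mult_distrib)
    have "0 \<le> a * b" using p by simp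
    then have "int (n - nat (a * b)) = x\<^sup>2"
      using p(4) \<open>nat (a * b) \<le> n\<close> by (simp add: of_nat_diff)
    show "(\<lambda>(x, a, b). (nat (a * b), (nat a, nat b), x)) p \<in> (SIGMA i:{0..n}. ?P i \<times> ?Q (n - i))"
      using p(1-3) ab \<open>nat (a * b) \<le> n\<close> \<open>int (n - nat (a * b)) = x\<^sup>2\<close> by simp
  qed
  also have "\<dots> = (-1) ^ n * real_of_int (\<Sum>p \<in> triples 1 (int n). ?e p * f p)"
    by (simp add: sum_distrib_left)
  also have "(\<Sum>p \<in> triples 1 (int n). ?e p * f p) =
      (\<Sum>p \<in> triples 1 (int n). 2 * (if (\<lambda>(x, a, b). even a \<and> even b) p then f p else 0) - f p)"
    by (rule sum.cong) (simp_all add: case_prod_unfold)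
  also have "\<dots> = 2 * (\<Sum>p \<in> {p \<in> triples 1 (int n). (\<lambda>(x, a, b). even a \<and> even b) p}. f p) - sum f (triples 1 (int n))"
    by (simp add: sum_subtractf sum_distrib_left[symmetric] sum.inter_filter finite_triples)
  also have "{p \<in> triples 1 (int n). (\<lambda>(x, a, b). even a \<and> even b) p} = triples 2 (int n)"
    by (auto simp: triples_def)
  finally show ?thesis unfolding f_def .
qed

text \<open>In each coefficient the contribution \<open>- 4 * n * fps_nth theta n\<close> of the
  constant 1 must cancel against the sum over triples; both vanish unless \<open>n\<close> is a
  positive square.\<close>

lemma theta_ode: "fps_deriv (1 - 8 * U 1) * theta = 4 * (1 - 8 * U 1) * fps_deriv theta"
proof -
  let ?u = "1 - 8 * U 1"
  \<comment> \<open>The factor \<open>fps_X\<close> makes differentiation multiply the coefficient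
    of index \<open>i\<close> by \<open>i\<close>, without an index shift.\<close>
  have "fps_X * (fps_deriv ?u * theta - 4 * ?u * fps_deriv theta) = 0"
  proof (rule fps_ext)
    fix n
    have XD: "fps_nth (fps_X * fps_deriv f) i = real i * fps_nth f i" for f :: "real fps" and i
      by (cases i) auto
    have u: "fps_nth ?u i = (if i = 0 then 1 else 0) - 8 * fps_nth (U 1) i" for i
      by (simp add: numeral_mult_nth)
    have "fps_nth (fps_X * (fps_deriv ?u * theta - 4 * ?u * fps_deriv theta)) n =
      fps_nth ((fps_X * fps_deriv ?u) * theta - 4 * (?u * (fps_X * fps_deriv theta))) n"
      by (simp only: algebra_simps)
    also have "\<dots> = (\<Sum>i = 0..n. real i * fps_nth ?u i * fps_nth theta (n - i)) -
       4 * (\<Sum>i = 0..n. fps_nth ?u i * (real (n - i) * fps_nth theta (n - i)))"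
      unfolding fps_sub_nth numeral_mult_nth fps_mult_nth[of "fps_X * fps_deriv ?u" theta]
        fps_mult_nth[of ?u "fps_X * fps_deriv theta"] XD ..
    also have "\<dots> = (\<Sum>i = 0..n. (5 * real i - 4 * real n) * fps_nth ?u i * fps_nth theta (n - i))"
      unfolding sum_distrib_left sum_subtractf[symmetric]
      by (rule sum.cong) (auto simp: of_nat_diff algebra_simps)
    also have "\<dots> = (\<Sum>i = 0..n. (if i = 0 then - 4 * real n * fps_nth theta n else 0)
       - 8 * ((5 * real i - 4 * real n) * fps_nth (U 1) i * fps_nth theta (n - i)))"
      unfolding u by (rule sum.cong) (auto simp: algebra_simps)
    also have "\<dots> = - 4 * real n * fps_nth theta n -
      8 * (\<Sum>i = 0..n. (5 * real i - 4 * real n) * fps_nth (U 1) i * fps_nth theta (n - i))"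
      by (simp add: sum_subtractf sum_distrib_left)
    also have "\<dots> = 0"
    proof (cases "\<exists>s. n = s\<^sup>2")
      case True
      then obtain s where n: "n = s\<^sup>2" ..
      show ?thesis
      proof (cases "s = 0")
        case True
        then show ?thesis using n U1_theta_convolution[of 0] by (simp add: U_def lambert_nth dsum_zero)
      next
        case False
        then have "{x :: int. x\<^sup>2 = int n} = {int s, - int s}"
          using n by (auto simp: power2_eq_iff)
        then have theta: "fps_nth theta n = (-1) ^ n * 2"
          using False by (simp add: theta_nth)
        have "6 * (\<Sum>(x, a, b) \<in> triples 1 (int n). a * (a * b - 4 * x\<^sup>2)) = int s * (8 * int s ^ 3 - 2 * int s)"
          using sum_triples_square[of 1 "2 * s" s] False n by simp
        moreover have "6 * (\<Sum>(x, a, b) \<in> triples 2 (int n). a * (a * b - 4 * x\<^sup>2)) = int s * 4 * (int s ^ 3 - int s)"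
          using sum_triples_square[of 2 s s] False n by simp
        \<comment> \<open>The quartic terms cancel:
          \<open>8 * (s ^ 4 - s ^ 2) - (8 * s ^ 4 - 2 * s ^ 2) = - 6 * s ^ 2\<close>.\<close>
        ultimately have "2 * (\<Sum>(x, a, b) \<in> triples 2 (int n). a * (a * b - 4 * x\<^sup>2))
          - (\<Sum>(x, a, b) \<in> triples 1 (int n). a * (a * b - 4 * x\<^sup>2)) = - int n"
          using n by (simp add: algebra_simps power2_eq_square power3_eq_cube)
        then show ?thesis unfolding U1_theta_convolution theta by (simp only:) simp
      qed
    next
      case False
      then have "{x :: int. x\<^sup>2 = int n} = {}"
        using square_int_eq_nat by blast
      then have "fps_nth theta n = 0" by (simp add: theta_nth)
      then show ?thesis
        unfolding U1_theta_convolution using sum_triples_nonsquare[of 1 n] sum_triples_nonsquare[of 2 n] False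
        by auto
    qed
    finally show "fps_nth (fps_X * (fps_deriv ?u * theta - 4 * ?u * fps_deriv theta)) n = fps_nth 0 n"
      by simp
  qed
  then show ?thesis by simp
qed

text \<open>By \<open>theta_ode\<close> the quotient of \<open>1 - 8 * U 1\<close> by
  \<open>theta ^ 4\<close> has derivative 0, and its constant coefficient is 1.\<close>

lemma theta_power_four: "theta ^ 4 = 1 - 8 * U 1"
proof -
  let ?u = "1 - 8 * U 1" and ?i = "inverse theta"
  have "{x :: int. x\<^sup>2 = 0} = {0}" by auto
  then have theta0: "fps_nth theta 0 = 1" by (simp add: theta_nth)
  then have inv: "?i * theta = 1" by (simp add: inverse_mult_eq_1)
  have i': "fps_deriv ?i = - fps_deriv theta * ?i\<^sup>2"
    using theta0 by (intro fps_inverse_deriv) simp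
  have "fps_deriv (?u * ?i ^ 4) = fps_deriv ?u * ?i ^ 4 + ?u * (4 * ?i ^ 3 * fps_deriv ?i)"
    by (simp add: fps_deriv_power algebra_simps fps_numeral_fps_const)
  also have "\<dots> = 0"
  proof -
    have "fps_deriv ?u * ?i ^ 4 = fps_deriv ?u * ?i ^ 4 * (?i * theta)"
      by (simp only: inv mult_1_right)
    also have "\<dots> = (fps_deriv ?u * theta) * ?i ^ 5"
      by (simp add: eval_nat_numeral mult_ac)
    also have "\<dots> = 4 * ?u * fps_deriv theta * ?i ^ 5"
      by (simp only: theta_ode)
    also have "\<dots> = - (?u * (4 * ?i ^ 3 * fps_deriv ?i))"
      unfolding i' by (simp add: eval_nat_numeral mult_ac)
    finally show ?thesis by simp
  qed
  finally have "?u * ?i ^ 4 = fps_const (fps_nth (?u * ?i ^ 4) 0)"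
    using fps_deriv_eq_0_iff by blast
  also have "fps_nth (?u * ?i ^ 4) 0 = 1"
    by (simp add: theta0 U_def lambert_nth dsum_zero numeral_mult_nth fps_power_zeroth)
  finally have "?u * ?i ^ 4 = 1" by simp
  have "?u = ?u * (?i * theta) ^ 4"
    by (simp only: inv power_one mult_1_right)
  also have "\<dots> = (?u * ?i ^ 4) * theta ^ 4"
    by (simp only: power_mult_distrib mult.assoc)
  finally show ?thesis by (simp only: \<open>?u * ?i ^ 4 = 1\<close> mult_1_left)
qed

section \<open>Powers of theta count sums of squares\<close>

lemma rep_squares_Suc:
  "rep_squares (Suc s) n = (\<Sum>i = 0..n. card {x :: int. x\<^sup>2 = int i} * rep_squares s (n - i))"
proof -
  let ?L = "\<lambda>s n. {xs :: int list. length xs = s \<and> (\<Sum>x\<leftarrow>xs. x\<^sup>2) = int n}"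
  let ?Q = "\<lambda>i. {x :: int. x\<^sup>2 = int i}"
  have nonneg: "0 \<le> (\<Sum>x\<leftarrow>xs. x\<^sup>2)" for xs :: "int list"
    by (rule sum_list_nonneg) auto
  have "bij_betw (\<lambda>(i, x, xs). x # xs) (SIGMA i:{0..n}. ?Q i \<times> ?L s (n - i)) (?L (Suc s) n)"
  proof (rule bij_betw_byWitness[where f' = "\<lambda>xs. (nat ((hd xs)\<^sup>2), hd xs, tl xs)"])
    show "(\<lambda>xs. (nat ((hd xs)\<^sup>2), hd xs, tl xs)) ` ?L (Suc s) n \<subseteq> (SIGMA i:{0..n}. ?Q i \<times> ?L s (n - i))"
    proof
      fix p assume "p \<in> (\<lambda>xs. (nat ((hd xs)\<^sup>2), hd xs, tl xs)) ` ?L (Suc s) n"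
      then obtain x xs where p: "p = (nat (x\<^sup>2), x, xs)" "length xs = s" "x\<^sup>2 + (\<Sum>x\<leftarrow>xs. x\<^sup>2) = int n"
        by (auto simp: length_Suc_conv)
      moreover have "nat (x\<^sup>2) \<le> n" using p(3) nonneg[of xs] by linarith
      ultimately show "p \<in> (SIGMA i:{0..n}. ?Q i \<times> ?L s (n - i))"
        by (auto simp: of_nat_diff)
    qed
  qed (auto simp: length_Suc_conv of_nat_diff)
  then have "rep_squares (Suc s) n = card (SIGMA i:{0..n}. ?Q i \<times> ?L s (n - i))"
    unfolding rep_squares_def by (rule bij_betw_same_card[symmetric])
  also have "\<dots> = (\<Sum>i = 0..n. card (?Q i \<times> ?L s (n - i)))"
    by (rule card_SigmaI) (simp, intro ballI finite_cartesian_product finite_squares finite_rep_squares)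
  finally show ?thesis by (simp add: card_cartesian_product rep_squares_def)
qed

text \<open>The sign passes through Cauchy products because
  \<open>(-1) ^ i * (-1) ^ (n - i) = (-1) ^ n\<close>.\<close>

lemma theta_power_nth: "fps_nth (theta ^ s) n = (-1) ^ n * real (rep_squares s n)"
proof (induction s arbitrary: n)
  case 0
  have "{xs :: int list. length xs = 0 \<and> (\<Sum>x\<leftarrow>xs. x\<^sup>2) = int n} = (if n = 0 then {[]} else {})" by auto
  then show ?case unfolding rep_squares_def by simp
next
  case (Suc s)
  have "fps_nth (theta ^ Suc s) n =
      (\<Sum>i = 0..n. ((-1) ^ i * (-1) ^ (n - i)) * (real (card {x :: int. x\<^sup>2 = int i}) * real (rep_squares s (n - i))))"
    by (simp add: fps_mult_nth Suc.IH theta_nth mult_ac)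
  also have "\<dots> = (\<Sum>i = 0..n. (-1) ^ n * (real (card {x :: int. x\<^sup>2 = int i}) * real (rep_squares s (n - i))))"
    by (rule sum.cong) (auto simp flip: power_add)
  finally show ?case by (simp add: rep_squares_Suc sum_distrib_left)
qed

subsection \<open>Sixteen and twenty-four squares\<close>

lemma dsum_divisors:
  assumes "0 < n"
  shows "dsum n F = (\<Sum>d | d dvd n \<and> d > 0. F d (n div d))"
  unfolding dsum_def
  by (rule sum.reindex_bij_witness[where i = "\<lambda>d. (d, n div d)" and j = fst])
     (use assms in \<open>auto simp: dvd_def\<close>)

text \<open>The end terms of the Cauchy product vanish, which leaves the summation range of the
  theorem.\<close>

lemma fps_mult_nth_interior:
  fixes f g :: "real fps"
  assumes "fps_nth f 0 = 0" "fps_nth g 0 = 0"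
  shows "fps_nth (f * g) n = (\<Sum>m = 1..n - 1. fps_nth f m * fps_nth g (n - m))"
  unfolding fps_mult_nth
proof (rule sum.mono_neutral_right)
  show "\<forall>i \<in> {0..n} - {1..n - 1}. fps_nth f i * fps_nth g (n - i) = 0"
  proof
    fix i assume "i \<in> {0..n} - {1..n - 1}"
    then have "i = 0 \<or> i = n" by auto
    then show "fps_nth f i * fps_nth g (n - i) = 0" using assms by auto
  qed
qed auto

lemma U_nth: "0 < n \<Longrightarrow> fps_nth (U r) n = real_of_int (sigma_tilde r n)"
  by (simp add: U_def lambert_nth dsum_divisors sigma_tilde_def)

lemma G_nth: "0 < n \<Longrightarrow> fps_nth (G r) n = real_of_int (sigma_dagger r n)"
  by (simp add: G_def lambert_nth dsum_divisors sigma_dagger_def)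

lemma U_mult_nth: "fps_nth (U r * U s) n = (\<Sum>m = 1..n - 1. real_of_int (sigma_tilde r m * sigma_tilde s (n - m)))"
proof -
  have "fps_nth (U r * U s) n = (\<Sum>m = 1..n - 1. fps_nth (U r) m * fps_nth (U s) (n - m))"
    by (rule fps_mult_nth_interior) (simp_all add: U_def lambert_nth dsum_zero)
  also have "\<dots> = (\<Sum>m = 1..n - 1. real_of_int (sigma_tilde r m * sigma_tilde s (n - m)))"
    by (rule sum.cong) (auto simp: U_nth)
  finally show ?thesis .
qed

lemma G_mult_nth: "fps_nth (G r * G s) n = (\<Sum>m = 1..n - 1. real_of_int (sigma_dagger r m * sigma_dagger s (n - m)))"
proof -
  have "fps_nth (G r * G s) n = (\<Sum>m = 1..n - 1. fps_nth (G r) m * fps_nth (G s) (n - m))"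
    by (rule fps_mult_nth_interior) (simp_all add: G_def lambert_nth dsum_zero)
  also have "\<dots> = (\<Sum>m = 1..n - 1. real_of_int (sigma_dagger r m * sigma_dagger s (n - m)))"
    by (rule sum.cong) (auto simp: G_nth)
  finally show ?thesis .
qed

theorem theorem1p7:
  fixes n :: nat
  assumes "n > 0"
  shows "real (rep_squares 16 n) =
      - ((-1) ^ n) * (32 / 3) *
          real_of_int (sigma_tilde 1 n + sigma_tilde 3 n + sigma_tilde 5 n)
      + (-1) ^ n * (256 / 3) *
          real_of_int (\<Sum>m = 1..n - 1. sigma_tilde 1 m * sigma_tilde 5 (n - m)
                                      - sigma_tilde 3 m * sigma_tilde 3 (n - m))
    \<and> real (rep_squares 24 n) =
      (-1) ^ n * (16 / 9) *
          real_of_int (17 * sigma_dagger 3 n + 8 * sigma_dagger 5 n + 2 * sigma_dagger 7 n)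
      + (-1) ^ n * (512 / 9) *
          real_of_int (\<Sum>m = 1..n - 1. sigma_dagger 3 m * sigma_dagger 7 (n - m)
                                      - sigma_dagger 5 m * sigma_dagger 5 (n - m))"
proof
  \<comment> \<open>Here \<open>e\<close> will be \<open>(-1) ^ n\<close>; the relations carry
    factors 3 and 9 to avoid denominators until now.\<close>
  have scale: "e * t = - e * (32 / 3) * a + e * (256 / 3) * b" if "3 * t = - 32 * a + 256 * b" for e t a b :: real
  proof -
    have "t = - (32 / 3) * a + (256 / 3) * b" using that by simp
    then show ?thesis by (simp only:) (simp add: algebra_simps)
  qed
  have scale': "e * t = e * (16 / 9) * a + e * (512 / 9) * b" if "9 * t = 16 * a + 512 * b" for e t a b :: real
  proof -
    have "t = (16 / 9) * a + (512 / 9) * b" using that by simp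
    then show ?thesis by (simp only:) (simp add: algebra_simps)
  qed
  have rep: "real (rep_squares s n) = (-1) ^ n * fps_nth (theta ^ s) n" for s
    by (simp add: theta_power_nth flip: mult.assoc power_add)
  have "3 * theta ^ 16 = 3 - 32 * (U 1 + U 3 + U 5) + 256 * (U 1 * U 5 - U 3 * U 3)"
    using fourth_power_relation unfolding theta_power_four[symmetric] power_mult[symmetric] by simp
  then have "fps_nth (3 * theta ^ 16) n = fps_nth (3 - 32 * (U 1 + U 3 + U 5) + 256 * (U 1 * U 5 - U 3 * U 3)) n"
    by (rule arg_cong)
  \<comment> \<open>The constant 3 affects only the coefficient of index 0, and
    \<open>n > 0\<close>; the same holds for the constant 9 below.\<close>
  then have "3 * fps_nth (theta ^ 16) n = - 32 * real_of_int (sigma_tilde 1 n + sigma_tilde 3 n + sigma_tilde 5 n)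
      + 256 * real_of_int (\<Sum>m = 1..n - 1. sigma_tilde 1 m * sigma_tilde 5 (n - m) - sigma_tilde 3 m * sigma_tilde 3 (n - m))"
    using assms by (simp add: numeral_mult_nth fps_numeral_nth U_nth U_mult_nth sum_subtractf)
  then show "real (rep_squares 16 n) =
      - ((-1) ^ n) * (32 / 3) * real_of_int (sigma_tilde 1 n + sigma_tilde 3 n + sigma_tilde 5 n)
      + (-1) ^ n * (256 / 3) *
          real_of_int (\<Sum>m = 1..n - 1. sigma_tilde 1 m * sigma_tilde 5 (n - m) - sigma_tilde 3 m * sigma_tilde 3 (n - m))"
    unfolding rep by (rule scale)
  have "9 * theta ^ 24 = 9 + 16 * (17 * G 3 + 8 * G 5 + 2 * G 7) + 512 * (G 3 * G 7 - G 5 * G 5)"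
    using sixth_power_relation unfolding theta_power_four[symmetric] power_mult[symmetric] by simp
  then have "fps_nth (9 * theta ^ 24) n = fps_nth (9 + 16 * (17 * G 3 + 8 * G 5 + 2 * G 7) + 512 * (G 3 * G 7 - G 5 * G 5)) n"
    by (rule arg_cong)
  then have "9 * fps_nth (theta ^ 24) n = 16 * real_of_int (17 * sigma_dagger 3 n + 8 * sigma_dagger 5 n + 2 * sigma_dagger 7 n)
      + 512 * real_of_int (\<Sum>m = 1..n - 1. sigma_dagger 3 m * sigma_dagger 7 (n - m) - sigma_dagger 5 m * sigma_dagger 5 (n - m))"
    using assms by (simp add: numeral_mult_nth fps_numeral_nth G_nth G_mult_nth sum_subtractf)
  then show "real (rep_squares 24 n) =
      (-1) ^ n * (16 / 9) * real_of_int (17 * sigma_dagger 3 n + 8 * sigma_dagger 5 n + 2 * sigma_dagger 7 n)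
      + (-1) ^ n * (512 / 9) *
          real_of_int (\<Sum>m = 1..n - 1. sigma_dagger 3 m * sigma_dagger 7 (n - m) - sigma_dagger 5 m * sigma_dagger 5 (n - m))"
    unfolding rep by (rule scale')
qed

end
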